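(* For each positive integer $k$, the asymptotic density of the set $\mathscr{A}_k = \{n \geq 1 : \gcd(n, F_n) = k\}$ satisfies $$\mathbf{d}(\mathscr{A}_k) = \sum_{d = 1}^\infty \frac{\mu(d)}{\ell(dk)},$$ where $\mu$ is the Möbius function.
   Context: $(F_n)_{n \geq 1}$ is the sequence of Fibonacci numbers: $F_1 = F_2 = 1$ and $F_{n+2} = F_{n+1} + F_n$ for all integers $n \geq 1$. For a positive integer $m$, $z(m)$ (the rank of appearance) denotes the smallest positive integer $n$ such that $m$ divides $F_n$ (it always exists), and $\ell(m) := \operatorname{lcm}(m, z(m))$. For a set $\mathscr{S}$ of positive integers, its asymptotic density $\mathbf{d}(\mathscr{S})$ is the limit of $\#(\mathscr{S} \cap [1,x])/x$ as $x \to +\infty$, whenever this limit exists. *)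

theory Defs
  imports "HOL-Analysis.Analysis" "HOL-Number_Theory.Number_Theory"
    "HOL-Computational_Algebra.Squarefree"
begin

text \<open>For \<open>m \<ge> 1\<close> such an \<open>n\<close> always exists; since \<open>fib 0 = 0\<close>, the condition
  \<open>n > 0\<close> is essential.\<close>
definition rank_of_appearance :: "nat \<Rightarrow> nat" where
  "rank_of_appearance m = (LEAST n. n > 0 \<and> m dvd fib n)"

definition ell :: "nat \<Rightarrow> nat" where
  "ell m = lcm m (rank_of_appearance m)"

definition moebius_mu :: "nat \<Rightarrow> int" where
  "moebius_mu n = (if squarefree n then (-1) ^ card (prime_factors n) else 0)"

definition has_asymptotic_density :: "nat set \<Rightarrow> real \<Rightarrow> bool" where
  "has_asymptotic_density S d \<longleftrightarrow>
     ((\<lambda>x::real. real (card {n \<in> S. 1 \<le> n \<and> real n \<le> x}) / x) \<longlongrightarrow> d) at_top"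

definition gcd_fib_set :: "nat \<Rightarrow> nat set" where
  "gcd_fib_set k = {n. n \<ge> 1 \<and> gcd n (fib n) = k}"

end

theory Submission
  imports Defs
begin

text \<open>
  Since \<open>m\<close> divides \<open>gcd n (fib n)\<close> exactly when \<open>ell m\<close> divides \<open>n\<close>, Moebius inversion gives
  \<open>#(A\<^sub>k \<inter> [1, x]) = (\<Sum>d. \<mu>(d) * \<lfloor>x / ell (d * k)\<rfloor>)\<close>. Dividing by \<open>x\<close> and letting \<open>x\<close> tend to
  infinity, Tannery's theorem gives the density as soon as \<open>1 / ell d\<close> is summable over squarefree
  \<open>d\<close>. For this, split by the largest prime factor \<open>p\<close> of \<open>d = p * e\<close> and use only that \<open>ell d\<close> is a
  multiple of \<open>lcm d z\<close>, where \<open>z = z(p)\<close> is the rank of appearance of \<open>p\<close>. As \<open>p\<close> and \<open>z\<close> are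
  coprime, the sum over \<open>e\<close> is at most
  \<open>(\<Prod>q<p. 1 + gcd q z / q) / (p * z) \<le> 2 ^ \<omega>(z) * (\<Prod>q<p. 1 + 1 / q) / (p * z)\<close>, with \<open>q\<close> prime,
  which is \<open>O(p powr (-2/3) * z powr (-3/4))\<close>. This is summable over \<open>p\<close> because at most \<open>n\<close> primes
  have \<open>z(p) = n\<close>: they all divide \<open>fib n \<le> 2 ^ n\<close>.
\<close>

subsection \<open>The rank of appearance\<close>

text \<open>D'Ocagne's identity. It carries a repetition of residues at \<open>i\<close> and
  \<open>i + n\<close> back to a statement about \<open>fib n\<close> alone.\<close>

lemma fib_docagne:
  "int (fib (i + n)) * int (fib (Suc i)) - int (fib (Suc (i + n))) * int (fib i) = (-1) ^ i * int (fib n)"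
proof (induction i)
  case (Suc i)
  have "int (fib (Suc i + n)) * int (fib (Suc (Suc i))) - int (fib (Suc (Suc i + n))) * int (fib (Suc i))
     = - (int (fib (i + n)) * int (fib (Suc i)) - int (fib (Suc (i + n))) * int (fib i))"
    by (simp add: algebra_simps)
  then show ?case using Suc by simp
qed simp

text \<open>Pigeonhole: some pair of consecutive residues modulo \<open>m\<close> recurs, say at
  \<open>i\<close> and \<open>i + n\<close>. The left side of d'Ocagne's identity then vanishes
  modulo \<open>m\<close>, hence so does \<open>fib n\<close>.\<close>

lemma ex_dvd_fib:
  assumes "m > 0"
  shows "\<exists>n>0. m dvd fib n"
proof -
  define h where "h i = (fib i mod m, fib (Suc i) mod m)" for i
  have "range h \<subseteq> {..<m} \<times> {..<m}" using assms by (auto simp: h_def)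
  then have "finite (range h)" by (rule finite_subset) auto
  then have "\<not> inj h" using finite_imageD[of h UNIV] by auto
  then obtain i j where ij: "h i = h j" "i < j"
    unfolding inj_def by (metis linorder_neqE_nat)
  define n where "n = j - i"
  have j: "j = i + n" "n > 0" using ij by (auto simp: n_def)
  have c: "[int (fib i) = int (fib (i + n))] (mod int m)"
          "[int (fib (Suc i)) = int (fib (Suc (i + n)))] (mod int m)"
    using ij(1) j by (auto simp: h_def cong_def cong_int_iff simp del: fib.simps simp flip: zmod_int)
  have "[int (fib (i + n)) * int (fib (Suc i)) - int (fib (Suc (i + n))) * int (fib i)
      = int (fib i) * int (fib (Suc i)) - int (fib (Suc i)) * int (fib i)] (mod int m)"
    using c by (intro cong_diff cong_mult cong_refl) (auto simp: cong_sym_eq)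
  then have "int m dvd (-1) ^ i * int (fib n)"
    unfolding fib_docagne by (simp add: cong_0_iff)
  then have "int m dvd int (fib n)"
    by (cases "even i") auto
  then show ?thesis using j by auto
qed

lemma rank_of_appearance:
  assumes "m > 0"
  shows "rank_of_appearance m > 0" "m dvd fib (rank_of_appearance m)"
  using LeastI_ex[OF ex_dvd_fib[OF assms]] unfolding rank_of_appearance_def by auto

text \<open>Both directions rest on \<open>fib_gcd\<close>. In the first, \<open>m\<close> divides
  \<open>fib (gcd n z)\<close> for the rank \<open>z\<close>, and minimality of \<open>z\<close>
  forces \<open>gcd n z = z\<close>.\<close>

lemma dvd_fib_iff:
  assumes "m > 0"
  shows "m dvd fib n \<longleftrightarrow> rank_of_appearance m dvd n"
proof
  let ?z = "rank_of_appearance m"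
  note z = rank_of_appearance[OF assms]
  assume "m dvd fib n"
  with z have "m dvd fib (gcd n ?z)" by (simp add: fib_gcd)
  moreover have "gcd n ?z > 0" using z by simp
  ultimately have "?z \<le> gcd n ?z"
    unfolding rank_of_appearance_def by (intro Least_le) auto
  moreover have "gcd n ?z \<le> ?z" using z by (intro gcd_le2_nat) auto
  ultimately show "?z dvd n" by (metis gcd_dvd1 le_antisym)
next
  assume "rank_of_appearance m dvd n"
  then have "gcd (rank_of_appearance m) n = rank_of_appearance m" by (simp add: gcd_nat.absorb1)
  then have "fib (rank_of_appearance m) dvd fib n"
    by (metis fib_gcd gcd_dvd2)
  then show "m dvd fib n" using rank_of_appearance(2)[OF assms] dvd_trans by blast
qed

text \<open>Replaces a condition on the gcd by divisibility of \<open>n\<close> by a fixed number,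
  so that counting reduces to counting multiples.\<close>

lemma dvd_gcd_fib_iff: "m > 0 \<Longrightarrow> m dvd gcd n (fib n) \<longleftrightarrow> ell m dvd n"
  by (simp add: ell_def dvd_fib_iff)

lemma rank_of_appearance_dvd_mono:
  assumes "a dvd b" "b > 0"
  shows "rank_of_appearance a dvd rank_of_appearance b"
  using assms rank_of_appearance(2)[of b] dvd_fib_iff[of a] by (meson dvd_pos_nat dvd_trans)

lemma ell_pos: "m > 0 \<Longrightarrow> ell m > 0"
  using rank_of_appearance(1)[of m] by (simp add: ell_def lcm_pos_nat)

lemma ell_ge: "m > 0 \<Longrightarrow> m \<le> ell m"
  using ell_pos[of m] by (auto simp: ell_def intro: dvd_imp_le)

text \<open>Gives \<open>ell d \<le> ell (d * k)\<close>, so that the series for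
  \<open>k = 1\<close> serves as a majorant for every \<open>k\<close>.\<close>

lemma ell_mono:
  assumes "a dvd b" "b > 0"
  shows "ell a \<le> ell b"
proof (rule dvd_imp_le)
  show "ell a dvd ell b"
    using assms rank_of_appearance_dvd_mono[OF assms] unfolding ell_def by (intro lcm_mono)
qed (use assms ell_pos in auto)

subsection \<open>Squarefree numbers and the Moebius function\<close>

lemma prime_factors_prod_primes:
  fixes T :: "nat set"
  assumes "finite T" "\<And>p. p \<in> T \<Longrightarrow> prime p"
  shows "prime_factors (\<Prod>T) = T"
proof -
  have "0 \<notin> T" using assms by force
  then have "prime_factors (\<Prod>T) = (\<Union>p\<in>T. prime_factors p)"
    using assms(1) by (subst prime_factors_prod) auto
  also have "\<dots> = (\<Union>p\<in>T. {p})" using assms by (intro SUP_cong) (auto simp: prime_factorization_prime)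
  finally show ?thesis by simp
qed

lemma squarefree_prod_primes:
  fixes T :: "nat set"
  assumes "\<And>p. p \<in> T \<Longrightarrow> prime p"
  shows "squarefree (\<Prod>T)"
  using assms by (intro squarefree_prod_coprime) (auto intro: primes_coprime squarefree_prime)

lemma prod_prime_factors_dvd:
  fixes n :: nat
  assumes "n > 0"
  shows "\<Prod>(prime_factors n) dvd n"
proof -
  have "\<Prod>(prime_factors n) dvd (\<Prod>p\<in>prime_factors n. p ^ multiplicity p n)"
    by (intro prod_dvd_prod) (auto simp: prime_factors_multiplicity)
  then show ?thesis using assms by (simp add: prod_prime_factors)
qed

lemma squarefree_prod_prime_factors:
  fixes d :: nat
  assumes "squarefree d"
  shows "\<Prod>(prime_factors d) = d"
proof -
  have "d \<noteq> 0" using assms by (intro notI) simp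
  have "d = (\<Prod>p\<in>prime_factors d. p ^ multiplicity p d)"
    using \<open>d \<noteq> 0\<close> by (simp add: prod_prime_factors)
  also have "\<dots> = (\<Prod>p\<in>prime_factors d. p)"
    using assms \<open>d \<noteq> 0\<close> by (intro prod.cong) (auto simp: squarefree_factorial_semiring')
  finally show ?thesis by simp
qed

text \<open>Encoding squarefree divisors by sets of primes turns a Moebius sum into a signed sum
  over subsets.\<close>

lemma bij_betw_prod_squarefree_divisors:
  fixes m :: nat
  assumes "m > 0"
  shows "bij_betw (\<lambda>T. \<Prod>T) (Pow (prime_factors m)) {d. d dvd m \<and> squarefree d}"
proof (rule bij_betwI[where g = prime_factors])
  show "(\<lambda>T. \<Prod>T) \<in> Pow (prime_factors m) \<rightarrow> {d. d dvd m \<and> squarefree d}"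
  proof safe
    fix T assume T: "T \<subseteq> prime_factors m"
    have "\<Prod>T dvd \<Prod>(prime_factors m)" using T by (intro prod_dvd_prod_subset) auto
    then show "\<Prod>T dvd m" using prod_prime_factors_dvd[OF assms] dvd_trans by blast
    show "squarefree (\<Prod>T)" using T by (intro squarefree_prod_primes) auto
  qed
  show "prime_factors \<in> {d. d dvd m \<and> squarefree d} \<rightarrow> Pow (prime_factors m)"
    using assms dvd_prime_factors[of m] by auto
  show "prime_factors (\<Prod>T) = T" if "T \<in> Pow (prime_factors m)" for T
    using that by (intro prime_factors_prod_primes) (auto intro: finite_subset)
  show "\<Prod>(prime_factors d) = d" if "d \<in> {d. d dvd m \<and> squarefree d}" for d
    using that by (intro squarefree_prod_prime_factors) auto
qed

text \<open>Indexed by sets of prime factors, the sum expands a product of factors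
  \<open>1 - 1\<close>, which is nonzero only when \<open>m\<close> has no prime factor.\<close>

lemma sum_moebius_divisors:
  assumes "m > 0"
  shows "(\<Sum>d | d dvd m. moebius_mu d) = (if m = 1 then 1 else 0)"
proof -
  have "(\<Sum>d | d dvd m. moebius_mu d) = (\<Sum>d | d dvd m \<and> squarefree d. moebius_mu d)"
    using assms by (intro sum.mono_neutral_right) (auto simp: moebius_mu_def)
  also have "\<dots> = (\<Sum>T\<in>Pow (prime_factors m). moebius_mu (\<Prod>T))"
    by (rule sum.reindex_bij_betw[OF bij_betw_prod_squarefree_divisors[OF assms], symmetric])
  also have "\<dots> = (\<Sum>T\<in>Pow (prime_factors m). (-1) ^ card T)"
  proof (rule sum.cong)
    fix T assume "T \<in> Pow (prime_factors m)"
    then have T: "\<And>p. p \<in> T \<Longrightarrow> prime p" "finite T" by (auto intro: finite_subset)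
    show "moebius_mu (\<Prod>T) = (-1) ^ card T"
      using squarefree_prod_primes[OF T(1)] prime_factors_prod_primes[OF T(2,1)]
      by (simp add: moebius_mu_def)
  qed simp
  also have "\<dots> = (\<Prod>p\<in>prime_factors m. 1 - 1)"
    by (subst prod_diff_conv_sum) auto
  also have "\<dots> = (if m = 1 then 1 else 0)"
  proof (cases "m = 1")
    case False
    then have "prime_factors m \<noteq> {}" using assms by (auto simp: prime_factorization_empty_iff)
    then have "card (prime_factors m) > 0" by (metis card_gt_0_iff finite_set_mset)
    then show ?thesis using False by simp
  qed auto
  finally show ?thesis .
qed

subsection \<open>The rank of appearance of a prime\<close>

text \<open>Binet's formula with both powers expanded binomially: the even powers of
  \<open>sqrt 5\<close> cancel and the odd ones double.\<close>

lemma fib_binomial: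
  "2 ^ n * fib n = 2 * (\<Sum>k\<le>n. if odd k then (n choose k) * 5 ^ (k div 2) else 0)"
proof -
  have *: "sqrt 5 ^ k - (- sqrt 5) ^ k = sqrt 5 * (if odd k then 2 * 5 ^ (k div 2) else 0)" for k
    by (auto elim!: evenE oddE simp: power_mult)
  have "sqrt 5 * real (2 ^ n * fib n) = (1 + sqrt 5) ^ n - (1 - sqrt 5) ^ n"
    by (simp add: fib_closed_form power_divide field_simps)
  also have "\<dots> = (sqrt 5 + 1) ^ n - (- sqrt 5 + 1) ^ n" by (simp add: add.commute)
  also have "\<dots> = (\<Sum>k\<le>n. real (n choose k) * (sqrt 5 ^ k - (- sqrt 5) ^ k))"
    unfolding binomial_ring by (simp add: sum_subtractf algebra_simps)
  also have "\<dots> = sqrt 5 * real (2 * (\<Sum>k\<le>n. if odd k then (n choose k) * 5 ^ (k div 2) else 0))"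
    unfolding * by (simp add: sum_distrib_left of_nat_sum if_distrib cong: if_cong) (auto intro!: sum.cong)
  finally show ?thesis by (simp only: mult_cancel_left of_nat_eq_iff) auto
qed

text \<open>Modulo \<open>p\<close> only the term \<open>k = p\<close> of the binomial expansion survives, so
  \<open>2 ^ p * fib p \<equiv> 2 * 5 ^ (p div 2)\<close>; squaring and Fermat's theorem remove both powers.\<close>

lemma fib_prime_square_cong:
  assumes p: "prime p" "p \<noteq> 2" "p \<noteq> 5"
  shows "[(fib p)\<^sup>2 = 1] (mod p)"
proof -
  have odd: "odd p" using primes_dvd_imp_eq[OF two_is_prime_nat p(1)] p(2) by auto
  have ncp: "coprime p 2" "coprime p 5" "\<not> p dvd 2" "\<not> p dvd 5"
    using p odd primes_dvd_imp_eq[OF p(1) two_is_prime_nat] primes_dvd_imp_eq[OF p(1), of 5]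
    by (auto simp: primes_coprime)
  have "[(\<Sum>k\<le>p. if odd k then (p choose k) * 5 ^ (k div 2) else 0) =
         (\<Sum>k\<le>p. if k = p then 5 ^ (p div 2) else 0)] (mod p)"
  proof (rule cong_sum)
    fix k assume k: "k \<in> {..p}"
    \<comment> \<open>Oddness excludes \<open>k = 0\<close>, so \<open>0 < k < p\<close> and the
      prime \<open>p\<close> divides the binomial coefficient.\<close>
    have "p dvd (p choose k)" if "odd k" "k \<noteq> p"
      using that p k by (intro dvd_choose_prime) (auto elim: oddE)
    then show "[(if odd k then (p choose k) * 5 ^ (k div 2) else 0) =
          (if k = p then 5 ^ (p div 2) else 0)] (mod p)"
      using odd by (auto simp: cong_0_iff)
  qed
  then have "[2 ^ p * fib p = 2 * 5 ^ (p div 2)] (mod p)"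
    unfolding fib_binomial by (intro cong_mult) auto
  then have "[(2 ^ p * fib p)\<^sup>2 = (2 * 5 ^ (p div 2))\<^sup>2] (mod p)" by (rule cong_pow)
  moreover have "(2 ^ p * fib p)\<^sup>2 = 2\<^sup>2 * ((2 ^ (p - 1))\<^sup>2 * (fib p)\<^sup>2)"
  proof -
    have "(2::nat) ^ p = 2 * 2 ^ (p - 1)" using odd by (cases p) auto
    then show ?thesis by (simp add: power_mult_distrib)
  qed
  moreover have "(2 * 5 ^ (p div 2))\<^sup>2 = (2\<^sup>2 * 5 ^ (p - 1) :: nat)"
    using odd by (auto elim!: oddE simp: power_mult_distrib mult.commute simp flip: power_mult)
  ultimately have "[2\<^sup>2 * ((2 ^ (p - 1))\<^sup>2 * (fib p)\<^sup>2) = 2\<^sup>2 * 5 ^ (p - 1)] (mod p)" by simp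
  then have 1: "[(2 ^ (p - 1))\<^sup>2 * (fib p)\<^sup>2 = 5 ^ (p - 1)] (mod p)"
    using cong_mult_lcancel_nat[of "2\<^sup>2" p] coprime_power_left_iff[of 2 2 p] ncp(1)
    by (metis coprime_commute)
  have "[(2 ^ (p - 1))\<^sup>2 * (fib p)\<^sup>2 = 1\<^sup>2 * (fib p)\<^sup>2] (mod p)"
    using fermat_theorem[OF p(1) ncp(3)] by (intro cong_mult cong_pow cong_refl) auto
  then show ?thesis using 1 fermat_theorem[OF p(1) ncp(4)]
    by (metis cong_sym cong_trans mult_1 one_power2)
qed

text \<open>By Cassini's identity at odd \<open>p\<close>,
  \<open>fib (p + 1) * fib (p - 1) = (fib p)\<^sup>2 - 1\<close>, a multiple of \<open>p\<close>. So
  the rank divides \<open>p + 1\<close> or \<open>p - 1\<close>, both coprime to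
  \<open>p\<close>.\<close>

lemma coprime_rank_of_appearance_prime:
  assumes p: "prime p" "p \<noteq> 2" "p \<noteq> 5"
  shows "coprime p (rank_of_appearance p)"
proof -
  have odd: "odd p" using primes_dvd_imp_eq[OF two_is_prime_nat p(1)] p(2) by auto
  have "int (fib (Suc p) * fib (p - 1)) = int ((fib p)\<^sup>2) - 1"
    using fib_Cassini_int[of "p - 1"] odd by (cases p) auto
  moreover have "[int ((fib p)\<^sup>2) = int 1] (mod int p)"
    using fib_prime_square_cong[OF assms] by (simp only: cong_int_iff)
  ultimately have "int p dvd int (fib (Suc p) * fib (p - 1))"
    by (simp only: cong_iff_dvd_diff of_nat_1)
  then have "p dvd fib (Suc p) * fib (p - 1)" by (simp only: int_dvd_int_iff)
  then have "p dvd fib (Suc p) \<or> p dvd fib (p - 1)" using p by (simp add: prime_dvd_mult_iff)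
  then have z: "rank_of_appearance p dvd Suc p \<or> rank_of_appearance p dvd p - 1"
    using dvd_fib_iff[of p] p by (simp add: prime_gt_0_nat)
  have "coprime p (Suc p)" "coprime p (p - 1)"
    using p(1) coprime_diff_one_right_nat[OF prime_gt_0_nat[OF p(1)]] by auto
  with z show ?thesis by (meson coprime_divisors dvd_refl)
qed

subsection \<open>Absolute convergence\<close>

text \<open>Primes above 3 are \<open>\<plusminus> 1\<close> modulo 6, so raising \<open>k\<close> by one adds at most two factors, each at
  most \<open>1 / (1 - 1 / (6 * (k + 1)))\<close>. By Bernoulli's inequality their product, cubed, is at most
  \<open>(k + 1) / k\<close>, which telescopes. An exponent below 3/8 in the resulting growth rate is all that
  the final summation needs, so Mertens' theorem can be avoided.\<close>

lemma prod_one_plus_inverse_primes_cubed_le: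
  assumes "k \<ge> 1"
  shows "(\<Prod>p | prime p \<and> p < 6 * k + 2. 1 + 1 / real p) ^ 3 \<le> 21 * real k"
  using assms
proof (induction k rule: dec_induct)
  case base
  have np: "\<not> prime (0::nat)" "\<not> prime (1::nat)" "\<not> prime (4::nat)" "\<not> prime (6::nat)" by simp_all
  have "p \<in> {2, 3, 5, 7}" if "prime p" "p < 8" for p :: nat
  proof -
    have "p \<in> {0, 1, 2, 3, 4, 5, 6, 7}" using that(2) by auto
    then show ?thesis using np that(1) by auto
  qed
  then have "{p::nat. prime p \<and> p < 6 * 1 + 2} = {2, 3, 5, 7}"
    by auto
  \<comment> \<open>The constant 21 comes from here: the product over 2, 3, 5, 7 is 96/35, whose
    cube is about 20.6.\<close>
  then show ?case by (simp add: power3_eq_cube)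
next
  case (step k)
  let ?A = "\<lambda>k. {p::nat. prime p \<and> p < 6 * k + 2}"
  let ?f = "\<lambda>p::nat. 1 + 1 / real p"
  have sub: "?A (Suc k) \<subseteq> ?A k \<union> {6 * k + 5, 6 * k + 7}"
  proof
    fix p assume p: "p \<in> ?A (Suc k)"
    show "p \<in> ?A k \<union> {6 * k + 5, 6 * k + 7}"
    proof (cases "p < 6 * k + 2")
      case False
      have "\<not> 2 dvd p" "\<not> 3 dvd p"
        using False p step(1) primes_dvd_imp_eq[of 2 p] primes_dvd_imp_eq[of 3 p] by auto
      moreover have "p < 6 * k + 8" using p by simp
      ultimately have "p = 6 * k + 5 \<or> p = 6 * k + 7" using False by presburger
      then show ?thesis by auto
    qed (use p in auto)
  qed
  have fin: "finite (?A k)" by simp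
  have "prod ?f (?A (Suc k)) \<le> prod ?f (?A k \<union> {6 * k + 5, 6 * k + 7})"
    using sub by (intro prod_mono2) auto
  also have "\<dots> = prod ?f (?A k) * (?f (6 * k + 5) * ?f (6 * k + 7))"
    using fin by (subst prod.union_disjoint) auto
  also have "\<dots> \<le> prod ?f (?A k) * (?f (6 * k + 5) * ?f (6 * k + 5))"
    by (intro mult_left_mono add_left_mono frac_le prod_nonneg) auto
  finally have "prod ?f (?A (Suc k)) ^ 3 \<le> (prod ?f (?A k) * (?f (6 * k + 5) * ?f (6 * k + 5))) ^ 3"
    by (intro power_mono prod_nonneg) auto
  also have "\<dots> = prod ?f (?A k) ^ 3 * ?f (6 * k + 5) ^ 6"
    by (simp add: power_mult_distrib flip: power_add)
  also have "\<dots> \<le> (21 * real k) * ((real k + 1) / real k)"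
  proof (intro mult_mono step.IH)
    define a where "a = 1 - 1 / (6 * (real k + 1))"
    have f: "?f (6 * k + 5) = 1 / a" by (simp add: a_def divide_simps) (simp add: algebra_simps)
    have "real k / (real k + 1) = 1 - 1 / (real k + 1)" by (simp add: divide_simps)
    also have "\<dots> \<le> a ^ 6"
    proof -
      have "6 * (1 / (6 * (real k + 1))) = 1 / (real k + 1)" by (simp add: divide_simps)
      then show ?thesis
        using Bernoulli_inequality[of "- (1 / (6 * (real k + 1)))" 6] unfolding a_def by simp
    qed
    finally have "1 / a ^ 6 \<le> 1 / (real k / (real k + 1))"
      using step(1) by (intro divide_left_mono) (auto simp: a_def)
    then show "?f (6 * k + 5) ^ 6 \<le> (real k + 1) / real k" unfolding f power_divide by simp
  qed auto
  also have "\<dots> = 21 * real (Suc k)" using step(1) by (simp add: divide_simps)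
  finally show ?case .
qed

lemma prod_one_plus_inverse_primes_le:
  assumes "n \<ge> 1"
  shows "(\<Prod>p | prime p \<and> p < n. 1 + 1 / real p) \<le> 3 * real n powr (1 / 3)"
proof (rule power_le_imp_le_base)
  \<comment> \<open>The choice \<open>k = n div 6 + 1\<close> is positive and makes
    \<open>6 * k + 2\<close> exceed \<open>n\<close>.\<close>
  have "(\<Prod>p | prime p \<and> p < n. 1 + 1 / real p) \<le> (\<Prod>p | prime p \<and> p < 6 * (n div 6 + 1) + 2. 1 + 1 / real p)"
    by (intro prod_mono2) auto
  then have "(\<Prod>p | prime p \<and> p < n. 1 + 1 / real p) ^ 3 \<le> \<dots> ^ 3"
    by (intro power_mono prod_nonneg) auto
  also have "\<dots> \<le> 21 * real (n div 6 + 1)"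
    by (intro prod_one_plus_inverse_primes_cubed_le) auto
  also have "\<dots> \<le> 27 * real n"
  proof -
    have "n div 6 + 1 \<le> n" using assms by presburger
    then have "real (n div 6 + 1) \<le> real n" by (simp only: of_nat_le_iff)
    then show ?thesis by simp
  qed
  also have "\<dots> = (3 * real n powr (1 / 3)) ^ Suc 2"
    using assms by (simp add: power_mult_distrib powr_powr flip: powr_realpow)
  finally show "(\<Prod>p | prime p \<and> p < n. 1 + 1 / real p) ^ Suc 2 \<le> (3 * real n powr (1 / 3)) ^ Suc 2"
    by simp
qed simp

section \<open>Bounds on the number of prime factors\<close>

text \<open>A prime \<open>q \<ge> 16\<close> absorbs its own factor 16. The smaller primes, crudely
  at most 16 in number, are paid for by the constant.\<close>

lemma sixteen_power_card_prime_factors_le: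
  fixes n :: nat
  assumes "n > 0"
  shows "16 ^ card (prime_factors n) \<le> 16 ^ 16 * n"
proof -
  let ?P = "prime_factors n"
  have "(16::nat) ^ card ?P = (\<Prod>q\<in>?P. 16)" by simp
  also have "\<dots> \<le> (\<Prod>q\<in>?P. (if q < (16::nat) then 16 else 1 :: nat) * q)"
    by (intro prod_mono) (auto simp: prime_factors_gt_0_nat Suc_le_eq)
  also have "\<dots> = (\<Prod>q\<in>?P. if q < (16::nat) then 16 else 1 :: nat) * \<Prod>?P" by (simp add: prod.distrib)
  also have "\<dots> \<le> 16 ^ 16 * n"
  proof (intro mult_mono)
    have "(\<Prod>q\<in>?P. if q < (16::nat) then 16 else 1 :: nat) = 16 ^ card {q \<in> ?P. q < 16}"
      by (simp add: prod.If_cases Int_def)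
    also have "card {q \<in> ?P. q < 16} \<le> card {..<16::nat}" by (intro card_mono) auto
    finally show "(\<Prod>q\<in>?P. if q < (16::nat) then 16 else 1 :: nat) \<le> (16::nat) ^ 16" by (simp add: power_increasing)
    show "\<Prod>?P \<le> n" using prod_prime_factors_dvd[OF assms] assms by (rule dvd_imp_le)
  qed auto
  finally show ?thesis .
qed

text \<open>The fourth root of the previous bound, as \<open>2 ^ 4 = 16\<close>.\<close>

lemma two_power_card_prime_factors_le_powr:
  fixes n :: nat
  assumes "n > 0"
  shows "2 ^ card (prime_factors n) \<le> 16 ^ 4 * real n powr (1 / 4)"
proof (rule power_le_imp_le_base)
  have "(2 ^ card (prime_factors n)) ^ Suc 3 = (16::real) ^ card (prime_factors n)"
    by (simp flip: power_mult power_mult_distrib add: mult.commute[of _ 4] power_mult)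
  also have "\<dots> = real (16 ^ card (prime_factors n))" by simp
  also have "\<dots> \<le> real (16 ^ 16 * n)"
    using sixteen_power_card_prime_factors_le[OF assms] by (simp only: of_nat_le_iff)
  also have "\<dots> = (16 ^ 4 * real n powr (1 / 4)) ^ Suc 3"
    using assms by (simp add: power_mult_distrib powr_powr flip: powr_realpow)
  finally show "(2 ^ card (prime_factors n)) ^ Suc 3 \<le> (16 ^ 4 * real n powr (1 / 4)) ^ Suc 3" .
qed simp

lemma two_power_card_prime_factors_le:
  fixes n :: nat
  assumes "n > 0"
  shows "2 ^ card (prime_factors n) \<le> n"
proof -
  have "(2::nat) ^ card (prime_factors n) = (\<Prod>q\<in>prime_factors n. 2)" by simp
  also have "\<dots> \<le> \<Prod>(prime_factors n)"
    by (intro prod_mono) (auto intro: prime_ge_2_nat)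
  also have "\<dots> \<le> n" using prod_prime_factors_dvd[OF assms] assms by (rule dvd_imp_le)
  finally show ?thesis .
qed

lemma fib_le_two_power: "fib n \<le> 2 ^ n"
  by (induction n rule: fib.induct) auto

text \<open>All these primes divide \<open>fib n\<close>, and a number at most \<open>2 ^ n\<close>
  has at most \<open>n\<close> distinct prime factors.\<close>

lemma card_primes_rank_of_appearance_le:
  assumes "finite S" "\<And>p. p \<in> S \<Longrightarrow> prime p \<and> rank_of_appearance p = n"
  shows "card S \<le> n"
proof (cases "S = {}")
  case False
  \<comment> \<open>Positivity matters: \<open>fib 0 = 0\<close> is divisible by every
    prime.\<close>
  then have n: "n > 0" using assms(2) rank_of_appearance(1) by (metis ex_in_conv prime_gt_0_nat)
  have "p dvd fib n" if "p \<in> S" for p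
    using assms(2)[OF that] rank_of_appearance(2)[of p] by (auto simp: prime_gt_0_nat)
  then have "S \<subseteq> prime_factors (fib n)"
    using assms(2) fib_neq_0_nat[OF n] by (auto simp: prime_factors_dvd)
  then have "card S \<le> card (prime_factors (fib n))" by (intro card_mono) auto
  then have "(2::nat) ^ card S \<le> 2 ^ card (prime_factors (fib n))" by (intro power_increasing) auto
  also have "\<dots> \<le> fib n" using fib_neq_0_nat[OF n] by (rule two_power_card_prime_factors_le)
  also have "\<dots> \<le> 2 ^ n" by (rule fib_le_two_power)
  finally show ?thesis by simp
qed simp

section \<open>The contribution of one largest prime factor\<close>

lemma gcd_mult_le: "gcd (a * b) z \<le> gcd a z * gcd b (z::nat)" if "z > 0"
proof (rule dvd_imp_le)
  show "gcd (a * b) z dvd gcd a z * gcd b z"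
    by (metis (no_types, lifting) dvd_mult gcd_dvd1 gcd_dvd2 gcd_greatest gcd_mult_distrib_nat mult.commute dvd_mult2)
qed (use that in auto)

text \<open>Distributes the gcd over the primes in \<open>T\<close>, so that the sum over
  \<open>T\<close> can be factored into an Euler product.\<close>

lemma gcd_prod_le: "gcd (prod f T) z \<le> (\<Prod>q\<in>T. gcd (f q) (z::nat))" if "z > 0"
proof (induction T rule: infinite_finite_induct)
  case (insert x T)
  have "gcd (prod f (insert x T)) z \<le> gcd (f x) z * gcd (prod f T) z"
    using insert gcd_mult_le[OF that, of "f x" "prod f T"] by simp
  also have "\<dots> \<le> gcd (f x) z * (\<Prod>q\<in>T. gcd (f q) z)"
    by (intro mult_left_mono insert) auto
  finally show ?case using insert by simp
qed (use that in auto)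

text \<open>The rank \<open>z\<close> of \<open>p\<close> divides that of \<open>p * e\<close>, so
  \<open>lcm (p * e) z\<close> divides \<open>ell (p * e)\<close>. Coprimality of \<open>p\<close>
  and \<open>z\<close> reduces \<open>gcd (p * e) z\<close> to \<open>gcd e z\<close>.\<close>

lemma inverse_ell_prime_mult_le:
  assumes p: "prime p" "p \<noteq> 2" "p \<noteq> 5" and e: "e > 0"
  defines "z \<equiv> rank_of_appearance p"
  shows "1 / real (ell (p * e)) \<le> real (gcd e z) / (real p * real e * real z)"
proof -
  have z: "z > 0" using rank_of_appearance(1)[OF prime_gt_0_nat[OF p(1)]] by (simp add: z_def)
  have pe: "p * e > 0" using p(1) e prime_gt_0_nat by simp
  have "lcm (p * e) z dvd ell (p * e)"
    using pe unfolding ell_def z_def by (intro lcm_mono rank_of_appearance_dvd_mono) auto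
  then have "lcm (p * e) z \<le> ell (p * e)" using ell_pos[OF pe] by (rule dvd_imp_le)
  then have le: "real (lcm (p * e) z) \<le> real (ell (p * e))" by simp
  have pos: "lcm (p * e) z > 0" using pe z by (simp add: lcm_pos_nat)
  have "gcd (p * e) z = gcd e z"
    using coprime_rank_of_appearance_prime[OF p] unfolding z_def
    by (simp add: gcd_mult_left_left_cancel coprime_commute)
  then have "gcd e z * lcm (p * e) z = p * e * z"
    using prod_gcd_lcm_nat[of "p * e" z] by simp
  then have eq: "real (gcd e z) * real (lcm (p * e) z) = real p * real e * real z"
    by (metis of_nat_mult)
  have "1 / real (ell (p * e)) \<le> 1 / real (lcm (p * e) z)"
    using le pos by (intro divide_left_mono) auto
  also have "\<dots> = real (gcd e z) / (real p * real e * real z)"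
    unfolding eq[symmetric] using z pos by (simp add: divide_simps)
  finally show ?thesis .
qed

text \<open>The numbers \<open>p * \<Prod>T\<close> are exactly the squarefree ones with largest
  prime factor \<open>p\<close>.\<close>

lemma sum_inverse_ell_prime_le:
  assumes p: "prime p" "p > 5"
  defines "z \<equiv> rank_of_appearance p"
  shows "(\<Sum>T\<in>Pow {q. prime q \<and> q < p}. 1 / real (ell (p * \<Prod>T)))
       \<le> 3 * 16 ^ 4 * (real p powr (-2/3) * real z powr (-3/4))"
proof -
  let ?A = "{q. prime q \<and> q < p}"
  have z: "z > 0" using rank_of_appearance(1)[OF prime_gt_0_nat[OF p(1)]] by (simp add: z_def)
  have p0: "p > 0" using p by simp
  have A: "finite ?A" by simp
  have "(\<Prod>q\<in>?A. real (gcd q z) / real q + 1)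
      \<le> (\<Prod>q\<in>?A. (1 + 1 / real q) * (if q dvd z then 2 else 1))"
  proof (intro prod_mono conjI)
    fix q assume q: "q \<in> ?A"
    \<comment> \<open>If \<open>q\<close> divides \<open>z\<close>, the left side is 2; otherwise
      the gcd is 1 and both sides agree.\<close>
    show "real (gcd q z) / real q + 1 \<le> (1 + 1 / real q) * (if q dvd z then 2 else 1)"
    proof (cases "q dvd z")
      case False
      have "prime q" using q by simp
      then have "gcd q z = 1" using prime_imp_coprime[OF _ False] coprime_imp_gcd_eq_1 by blast
      then show ?thesis using False by simp
    qed (use q in \<open>auto simp: gcd_nat.absorb1\<close>)
  qed auto
  also have "\<dots> = (\<Prod>q\<in>?A. 1 + 1 / real q) * 2 ^ card {q \<in> ?A. q dvd z}"
  proof -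
    have "(\<Prod>q\<in>?A. if q dvd z then 2 else 1) = (\<Prod>q\<in>{q \<in> ?A. q dvd z}. 2 :: real)"
      using A by (rule prod.inter_filter[symmetric])
    then show ?thesis by (simp only: prod.distrib prod_constant)
  qed
  also have "\<dots> \<le> (3 * real p powr (1 / 3)) * (16 ^ 4 * real z powr (1 / 4))"
  proof (intro mult_mono)
    show "(\<Prod>q\<in>?A. 1 + 1 / real q) \<le> 3 * real p powr (1 / 3)"
      using p by (intro prod_one_plus_inverse_primes_le) auto
    have "{q \<in> ?A. q dvd z} \<subseteq> prime_factors z" using z by (auto simp: prime_factors_dvd)
    then have "(2::real) ^ card {q \<in> ?A. q dvd z} \<le> 2 ^ card (prime_factors z)"
      by (intro power_increasing card_mono) auto
    also have "\<dots> \<le> 16 ^ 4 * real z powr (1 / 4)" by (rule two_power_card_prime_factors_le_powr[OF z])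
    finally show "(2::real) ^ card {q \<in> ?A. q dvd z} \<le> 16 ^ 4 * real z powr (1 / 4)" .
  qed auto
  finally have prod_le: "(\<Prod>q\<in>?A. real (gcd q z) / real q + 1)
      \<le> (3 * real p powr (1 / 3)) * (16 ^ 4 * real z powr (1 / 4))" .
  have "(\<Sum>T\<in>Pow ?A. 1 / real (ell (p * \<Prod>T)))
     \<le> (\<Sum>T\<in>Pow ?A. 1 / (real p * real z) * (\<Prod>q\<in>T. real (gcd q z) / real q))"
  proof (rule sum_mono)
    fix T assume T: "T \<in> Pow ?A"
    have pos: "\<Prod>T > 0" using T by (intro prod_pos) (auto simp: prime_gt_0_nat)
    have "1 / real (ell (p * \<Prod>T)) \<le> real (gcd (\<Prod>T) z) / (real p * real (\<Prod>T) * real z)"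
      unfolding z_def using p pos by (intro inverse_ell_prime_mult_le) auto
    also have "\<dots> \<le> real (\<Prod>q\<in>T. gcd q z) / (real p * real (\<Prod>T) * real z)"
      using gcd_prod_le[OF z, of "\<lambda>q. q" T]
      by (intro divide_right_mono mult_nonneg_nonneg of_nat_0_le_iff) (simp only: of_nat_le_iff)
    also have "\<dots> = 1 / (real p * real z) * (\<Prod>q\<in>T. real (gcd q z) / real q)"
      by (simp add: prod_dividef)
    finally show "1 / real (ell (p * \<Prod>T)) \<le> 1 / (real p * real z) * (\<Prod>q\<in>T. real (gcd q z) / real q)" .
  qed
  \<comment> \<open>Expanding the product over \<open>q\<close> gives one term for each subset
    \<open>T\<close>.\<close>
  also have "\<dots> = 1 / (real p * real z) * (\<Prod>q\<in>?A. real (gcd q z) / real q + 1)"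
    unfolding prod_add[OF A] by (simp add: sum_distrib_left)
  also have "\<dots> \<le> 1 / (real p * real z) * ((3 * real p powr (1 / 3)) * (16 ^ 4 * real z powr (1 / 4)))"
    using prod_le by (rule mult_left_mono) simp
  also have "\<dots> = 3 * 16 ^ 4 * ((real p powr (1/3) / real p powr 1) * (real z powr (1/4) / real z powr 1))"
    using p0 z by simp
  also have "\<dots> = 3 * 16 ^ 4 * (real p powr (-2/3) * real z powr (-3/4))"
    unfolding powr_diff[symmetric] by simp
  finally show ?thesis .
qed

text \<open>Primes with \<open>z(p)\<^sup>2 \<ge> p\<close> contribute at most \<open>p powr (-25/24)\<close>. The others are grouped by
  \<open>n = z(p)\<close>: there are at most \<open>n\<close> of them for each \<open>n\<close>, and each exceeds \<open>n\<^sup>2\<close>.\<close>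

lemma sum_primes_powr_rank_le:
  fixes P :: "nat set"
  assumes P: "finite P" "\<And>p. p \<in> P \<Longrightarrow> prime p"
  shows "(\<Sum>p\<in>P. real p powr (-2/3) * real (rank_of_appearance p) powr (-3/4))
     \<le> (\<Sum>n. real n powr (-25/24)) + (\<Sum>n. real n powr (-13/12))"
proof -
  let ?z = rank_of_appearance
  let ?f = "\<lambda>p. real p powr (-2/3) * real (?z p) powr (-3/4)"
  let ?B = "{p \<in> P. (?z p)\<^sup>2 < p}"
  have summ: "summable (\<lambda>n. real n powr (-25/24))" "summable (\<lambda>n. real n powr (-13/12))"
    by (auto simp: summable_real_powr_iff)
  have "sum ?f P = sum ?f (P - ?B) + sum ?f ?B"
    using P by (intro sum.subset_diff) auto
  also have "sum ?f (P - ?B) \<le> (\<Sum>p\<in>P - ?B. real p powr (-25/24))"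
  proof (rule sum_mono)
    fix p assume p: "p \<in> P - ?B"
    have p0: "p > 0" using p P(2) prime_gt_0_nat by auto
    have "real p \<le> real ((?z p)\<^sup>2)" using p by (subst of_nat_le_iff) auto
    then have "real (?z p) powr (-3/4) \<le> (real p powr (1/2)) powr (-3/4)"
      using p0 by (intro powr_mono2') (auto simp: powr_half_sqrt real_le_lsqrt)
    then have "?f p \<le> real p powr (-2/3) * (real p powr (1/2)) powr (-3/4)"
      by (intro mult_left_mono) auto
    \<comment> \<open>The exponent is \<open>-2/3 - 3/8\<close>.\<close>
    also have "\<dots> = real p powr (-25/24)" by (simp add: powr_powr flip: powr_add)
    finally show "?f p \<le> real p powr (-25/24)" .
  qed
  also have "\<dots> \<le> (\<Sum>n. real n powr (-25/24))"
    using summ P by (intro sum_le_suminf) auto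
  also have "sum ?f ?B = (\<Sum>n\<in>?z ` ?B. \<Sum>p\<in>{p \<in> ?B. ?z p = n}. ?f p)"
    using P by (intro sum.image_gen) auto
  also have "\<dots> \<le> (\<Sum>n\<in>?z ` ?B. real n powr (-13/12))"
  proof (rule sum_mono)
    fix n assume n: "n \<in> ?z ` ?B"
    then have n0: "n > 0" using P(2) rank_of_appearance(1) prime_gt_0_nat by auto
    \<comment> \<open>From \<open>n\<^sup>2 < p\<close> the exponent becomes
      \<open>-4/3 - 3/4 = -25/12\<close>. The at most \<open>n\<close> primes in the group raise it
      to \<open>-13/12\<close>, still below -1.\<close>
    have "(\<Sum>p\<in>{p \<in> ?B. ?z p = n}. ?f p) \<le> (\<Sum>p\<in>{p \<in> ?B. ?z p = n}. real n powr (-25/12))"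
    proof (rule sum_mono)
      fix p assume p: "p \<in> {p \<in> ?B. ?z p = n}"
      then have "real n powr 2 \<le> real p" using n0 by (auto simp flip: of_nat_power)
      then have "real p powr (-2/3) \<le> (real n powr 2) powr (-2/3)"
        using n0 by (intro powr_mono2') auto
      then have "?f p \<le> (real n powr 2) powr (-2/3) * real n powr (-3/4)"
        using p by (auto intro: mult_right_mono)
      also have "\<dots> = real n powr (-25/12)" by (simp add: powr_powr flip: powr_add del: powr_numeral)
      finally show "?f p \<le> real n powr (-25/12)" .
    qed
    also have "\<dots> = real (card {p \<in> ?B. ?z p = n}) * real n powr (-25/12)" by simp
    also have "\<dots> \<le> real n * real n powr (-25/12)"
      using P by (intro mult_right_mono) (auto intro: card_primes_rank_of_appearance_le)
    also have "\<dots> = real n powr 1 * real n powr (-25/12)" using n0 by simp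
    also have "\<dots> = real n powr (-13/12)" unfolding powr_add[symmetric] by simp
    finally show "(\<Sum>p\<in>{p \<in> ?B. ?z p = n}. ?f p) \<le> real n powr (-13/12)" .
  qed
  also have "\<dots> \<le> (\<Sum>n. real n powr (-13/12))"
    using summ P by (intro sum_le_suminf) auto
  finally show ?thesis by simp
qed

section \<open>Summation over the largest prime factor\<close>

text \<open>Nonempty sets of primes are sorted by their largest element \<open>p\<close>; the empty
  set yields \<open>1 / ell 1\<close>. In the induction a new prime \<open>N\<close> splits the
  subsets into those with and without \<open>N\<close>.\<close>

lemma sum_inverse_ell_prod_primes_eq:
  "(\<Sum>T\<in>Pow {q. prime q \<and> q < N}. 1 / real (ell (\<Prod>T)))
   = 1 / real (ell 1) + (\<Sum>p | prime p \<and> p < N. \<Sum>T\<in>Pow {q. prime q \<and> q < p}. 1 / real (ell (p * \<Prod>T)))"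
proof (induction N)
  case (Suc N)
  let ?A = "\<lambda>N::nat. {q. prime q \<and> q < N}"
  let ?g = "\<lambda>T. 1 / real (ell (\<Prod>T))"
  show ?case
  proof (cases "prime N")
    case True
    have A: "?A (Suc N) = insert N (?A N)" using True by auto
    have "sum ?g (Pow (?A (Suc N))) = sum ?g (Pow (?A N)) + sum ?g (insert N ` Pow (?A N))"
      unfolding A Pow_insert by (intro sum.union_disjoint) auto
    also have "sum ?g (insert N ` Pow (?A N)) = (\<Sum>T\<in>Pow (?A N). ?g (insert N T))"
    proof (subst sum.reindex)
      show "inj_on (insert N) (Pow (?A N))"
        by (rule inj_on_inverseI[where g = "\<lambda>T. T - {N}"]) auto
    qed simp
    also have "\<dots> = (\<Sum>T\<in>Pow (?A N). 1 / real (ell (N * \<Prod>T)))"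
    proof (intro sum.cong refl)
      fix T assume T: "T \<in> Pow (?A N)"
      then have "finite T" "N \<notin> T" by (auto intro: finite_subset)
      then show "?g (insert N T) = 1 / real (ell (N * \<Prod>T))" by simp
    qed
    finally show ?thesis unfolding Suc.IH A by simp
  next
    case False
    then have A: "?A (Suc N) = ?A N" by (auto simp: less_Suc_eq)
    show ?thesis using Suc.IH unfolding A .
  qed
qed simp

text \<open>The terms are nonnegative, so a uniform bound on the partial sums suffices.\<close>

lemma summable_moebius_ell:
  "summable (\<lambda>d. \<bar>real_of_int (moebius_mu d)\<bar> / real (ell d))"
proof -
  let ?A = "\<lambda>N::nat. {q. prime q \<and> q < N}"
  define b where "b p = (\<Sum>T\<in>Pow (?A p). 1 / real (ell (p * \<Prod>T)))" for p
  have b_nonneg: "b p \<ge> 0" for p unfolding b_def by (intro sum_nonneg) simp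
  define S where "S = (\<Sum>n. real n powr (-25/24)) + (\<Sum>n. real n powr (-13/12))"
  \<comment> \<open>The three parts of \<open>C\<close> account for \<open>d = 1\<close>, for
    largest prime factor at most 5, where the estimate does not apply, and for the remaining
    primes.\<close>
  define C where "C = 1 / real (ell 1) + (sum b (?A 6) + 3 * 16 ^ 4 * S)"
  have W: "(\<Sum>T\<in>Pow (?A N). 1 / real (ell (\<Prod>T))) \<le> C" for N
  proof -
    let ?L = "{p. prime p \<and> 5 < p \<and> p < N}"
    have "sum b (?A N) \<le> sum b (?A 6 \<union> ?L)"
      by (intro sum_mono2) (auto simp: b_nonneg)
    also have "\<dots> = sum b (?A 6) + sum b ?L"
      by (intro sum.union_disjoint) auto
    finally have 1: "sum b (?A N) \<le> sum b (?A 6) + sum b ?L" .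
    have "sum b ?L \<le> (\<Sum>p\<in>?L. 3 * 16 ^ 4 * (real p powr (-2/3) * real (rank_of_appearance p) powr (-3/4)))"
      unfolding b_def by (intro sum_mono sum_inverse_ell_prime_le) auto
    also have "\<dots> = 3 * 16 ^ 4 * (\<Sum>p\<in>?L. real p powr (-2/3) * real (rank_of_appearance p) powr (-3/4))"
      by (rule sum_distrib_left[symmetric])
    also have "\<dots> \<le> 3 * 16 ^ 4 * S"
      unfolding S_def by (intro mult_left_mono sum_primes_powr_rank_le) auto
    finally have "1 / real (ell 1) + sum b (?A N) \<le> C" using 1 unfolding C_def by linarith
    then show ?thesis unfolding sum_inverse_ell_prod_primes_eq b_def .
  qed
  show ?thesis
  proof (rule bounded_imp_summable)
    fix N :: nat
    let ?D = "{d. d \<le> N \<and> squarefree d}"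
    have "(\<Sum>d\<le>N. \<bar>real_of_int (moebius_mu d)\<bar> / real (ell d)) = (\<Sum>d\<in>?D. 1 / real (ell d))"
      \<comment> \<open>The index 0 drops out because 0 is not squarefree.\<close>
      by (rule sum.mono_neutral_cong_right) (auto simp: moebius_mu_def power_abs)
    also have "\<dots> = (\<Sum>d\<in>?D. 1 / real (ell (\<Prod>(prime_factors d))))"
      by (intro sum.cong) (auto simp: squarefree_prod_prime_factors)
    also have "\<dots> = (\<Sum>T\<in>prime_factors ` ?D. 1 / real (ell (\<Prod>T)))"
    proof (subst sum.reindex)
      show "inj_on prime_factors ?D"
        by (rule inj_on_inverseI[where g = "\<lambda>T. \<Prod>T"]) (auto simp: squarefree_prod_prime_factors)
    qed simp
    \<comment> \<open>A number \<open>d \<le> N\<close> has only prime factors below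
      \<open>Suc N\<close>; the additional sets contribute nonnegative terms.\<close>
    also have "\<dots> \<le> (\<Sum>T\<in>Pow (?A (Suc N)). 1 / real (ell (\<Prod>T)))"
    proof (intro sum_mono2)
      show "prime_factors ` ?D \<subseteq> Pow (?A (Suc N))"
      proof (intro image_subsetI PowI subsetI)
        fix d q assume d: "d \<in> ?D" and q: "q \<in> prime_factors d"
        have "d > 0" using d by (auto intro!: gr0I)
        then have "q \<le> d" using q by (intro dvd_imp_le) auto
        then show "q \<in> ?A (Suc N)" using d q by auto
      qed
    qed auto
    also have "\<dots> \<le> C" by (rule W)
    finally show "(\<Sum>d\<le>N. \<bar>real_of_int (moebius_mu d)\<bar> / real (ell d)) \<le> C" .
  qed auto
qed

subsection \<open>Counting and the passage to the limit\<close>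

lemma card_multiples:
  assumes "l > 0"
  shows "card {n \<in> {1..N}. l dvd n} = N div l"
proof -
  have "{n \<in> {1..N}. l dvd n} = (*) l ` {1..N div l}"
  proof (intro equalityI subsetI)
    fix n assume "n \<in> {n \<in> {1..N}. l dvd n}"
    then obtain j where "n = l * j" "1 \<le> l * j" "l * j \<le> N" by auto
    moreover from this have "j \<le> N div l" using assms by (simp add: less_eq_div_iff_mult_less_eq mult.commute)
    ultimately show "n \<in> (*) l ` {1..N div l}" using assms by (auto simp: Suc_le_eq)
  next
    fix n assume "n \<in> (*) l ` {1..N div l}"
    then obtain j where j: "n = l * j" "1 \<le> j" "j \<le> N div l"
      by (metis atLeastAtMost_iff imageE)
    then have "l * j \<le> N" using assms by (simp add: less_eq_div_iff_mult_less_eq mult.commute)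
    moreover have "1 \<le> l * j" using assms j(2) by (simp add: Suc_le_eq)
    ultimately show "n \<in> {n \<in> {1..N}. l dvd n}" unfolding j(1) by simp
  qed
  also have "card \<dots> = N div l" using assms by (subst card_image) (auto intro: inj_onI)
  finally show ?thesis .
qed

text \<open>If the gcd is \<open>k * m\<close>, the relevant \<open>d\<close> are the divisors of
  \<open>m\<close>, all at most \<open>N\<close>, and their Moebius sum detects
  \<open>m = 1\<close>. The range \<open>N\<close> is independent of \<open>n\<close>, which later
  allows the sums to be swapped.\<close>

lemma indicator_gcd_fib_eq_sum_moebius:
  assumes "k > 0" "1 \<le> n" "n \<le> N"
  shows "(if gcd n (fib n) = k then 1 else 0)
       = (\<Sum>d=1..N. moebius_mu d * (if ell (d * k) dvd n then 1 else 0))"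
proof -
  let ?g = "gcd n (fib n)"
  have "(\<Sum>d=1..N. moebius_mu d * (if ell (d * k) dvd n then 1 else 0))
      = (\<Sum>d=1..N. if d * k dvd ?g then moebius_mu d else 0)"
    using assms(1) dvd_gcd_fib_iff by (intro sum.cong) auto
  also have "\<dots> = (\<Sum>d | d \<in> {1..N} \<and> d * k dvd ?g. moebius_mu d)"
    by (subst sum.inter_filter) auto
  also have "\<dots> = (if ?g = k then 1 else 0)"
  proof (cases "k dvd ?g")
    case True
    then obtain m where m: "?g = k * m" by (rule dvdE)
    have "?g > 0" using assms by auto
    then have m0: "m > 0" using m by auto
    have "m \<le> ?g" using m assms(1) by (cases k) auto
    also have "?g \<le> N" using assms gcd_le1_nat[of n "fib n"] by linarith
    finally have "{d. d \<in> {1..N} \<and> d * k dvd ?g} = {d. d dvd m}"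
      using m m0 assms(1) by (auto simp: mult.commute[of k] Suc_le_eq intro: dvd_pos_nat dest: dvd_imp_le)
    then show ?thesis using sum_moebius_divisors[OF m0] m assms(1) by auto
  next
    case False
    then have "{d. d \<in> {1..N} \<and> d * k dvd ?g} = {}" using dvd_mult_right by blast
    moreover have "?g \<noteq> k" using False by auto
    ultimately show ?thesis by (simp only: sum.empty if_False)
  qed
  finally show ?thesis by simp
qed

lemma card_gcd_fib_set:
  assumes "k > 0"
  shows "int (card {n \<in> gcd_fib_set k. n \<le> N}) = (\<Sum>d=1..N. moebius_mu d * int (N div ell (d * k)))"
proof -
  have "{n \<in> gcd_fib_set k. n \<le> N} = {n \<in> {1..N}. gcd n (fib n) = k}"
    by (auto simp: gcd_fib_set_def)
  then have "int (card {n \<in> gcd_fib_set k. n \<le> N}) = (\<Sum>n=1..N. if gcd n (fib n) = k then 1 else 0)"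
    by (simp add: sum.If_cases Int_def)
  also have "\<dots> = (\<Sum>n=1..N. \<Sum>d=1..N. moebius_mu d * (if ell (d * k) dvd n then 1 else 0))"
    using assms by (intro sum.cong indicator_gcd_fib_eq_sum_moebius) auto
  also have "\<dots> = (\<Sum>d=1..N. moebius_mu d * (\<Sum>n=1..N. if ell (d * k) dvd n then 1 else 0))"
    by (subst sum.swap) (simp add: sum_distrib_left)
  also have "\<dots> = (\<Sum>d=1..N. moebius_mu d * int (N div ell (d * k)))"
  proof (intro sum.cong refl)
    fix d assume "d \<in> {1..N}"
    then have "ell (d * k) > 0" using assms by (intro ell_pos) auto
    from card_multiples[OF this, of N]
    show "moebius_mu d * (\<Sum>n=1..N. if ell (d * k) dvd n then 1 else 0) = moebius_mu d * int (N div ell (d * k))"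
      by (simp add: sum.If_cases Int_def)
  qed
  finally show ?thesis .
qed

section \<open>Limits of the single terms, and Tannery's theorem\<close>

lemma nat_floor_div:
  assumes "x \<ge> 0"
  shows "nat \<lfloor>x\<rfloor> div l = nat \<lfloor>x / real l\<rfloor>"
  using floor_divide_real_eq_div[of "int l" x] assms by (simp add: nat_div_distrib)

text \<open>Rounding \<open>x / l\<close> down costs at most 1, which is negligible after division
  by \<open>x\<close>.\<close>

lemma tendsto_floor_div:
  assumes "l > 0"
  shows "((\<lambda>x. real (nat \<lfloor>x\<rfloor> div l) / x) \<longlongrightarrow> 1 / real l) at_top"
proof (rule tendsto_sandwich)
  have ev: "eventually (\<lambda>x::real. x > 0) at_top" by (rule eventually_gt_at_top)
  show "eventually (\<lambda>x. 1 / real l - 1 / x \<le> real (nat \<lfloor>x\<rfloor> div l) / x) at_top"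
    using ev
  proof eventually_elim
    case (elim x)
    have "x / real l - 1 \<le> real (nat \<lfloor>x\<rfloor> div l)" using elim by (simp add: nat_floor_div)
    then have "(x / real l - 1) / x \<le> real (nat \<lfloor>x\<rfloor> div l) / x" using elim by (intro divide_right_mono) auto
    then show ?case using elim by (simp add: diff_divide_distrib)
  qed
  show "eventually (\<lambda>x. real (nat \<lfloor>x\<rfloor> div l) / x \<le> 1 / real l) at_top"
    using ev
  proof eventually_elim
    case (elim x)
    have "real (nat \<lfloor>x\<rfloor> div l) \<le> x / real l" using elim by (simp add: nat_floor_div)
    then have "real (nat \<lfloor>x\<rfloor> div l) / x \<le> x / real l / x" using elim by (intro divide_right_mono) auto
    then show ?case using elim by simp
  qed
  have "((\<lambda>x. 1 / real l - 1 / x) \<longlongrightarrow> 1 / real l - 0) at_top"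
    by (intro tendsto_diff tendsto_const tendsto_divide_0[OF tendsto_const] filterlim_at_top_imp_at_infinity filterlim_ident)
  then show "((\<lambda>x. 1 / real l - 1 / x) \<longlongrightarrow> 1 / real l) at_top" by simp
qed simp

theorem theorem1p4:
  fixes k :: nat
  assumes "k \<ge> 1"
  shows "\<exists>s :: real.
           (\<lambda>i. real_of_int (moebius_mu (Suc i)) / real (ell (Suc i * k))) sums s \<and>
           has_asymptotic_density (gcd_fib_set k) s"
proof -
  \<comment> \<open>The index \<open>i\<close> stands for \<open>d = i + 1\<close>.\<close>
  let ?b = "\<lambda>i. real_of_int (moebius_mu (Suc i)) / real (ell (Suc i * k))"
  let ?a = "\<lambda>i x. real_of_int (moebius_mu (Suc i)) * (real (nat \<lfloor>x\<rfloor> div ell (Suc i * k)) / x)"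
  \<comment> \<open>The majorant depends neither on \<open>x\<close> nor on
    \<open>k\<close>.\<close>
  let ?M = "\<lambda>i. \<bar>real_of_int (moebius_mu (Suc i))\<bar> / real (ell (Suc i))"
  have pos: "ell (Suc i * k) > 0" for i using assms by (intro ell_pos) auto
  have lim: "(?a i \<longlongrightarrow> ?b i) at_top" for i
    using tendsto_mult[OF tendsto_const tendsto_floor_div[OF pos[of i]], of "real_of_int (moebius_mu (Suc i))"]
    by simp
  have bound: "norm (?a i x) \<le> ?M i" if "x > 0" for i x
  proof -
    have "real (nat \<lfloor>x\<rfloor> div ell (Suc i * k)) \<le> x / real (ell (Suc i * k))"
      using that by (simp add: nat_floor_div)
    then have "real (nat \<lfloor>x\<rfloor> div ell (Suc i * k)) / x \<le> x / real (ell (Suc i * k)) / x"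
      using that by (intro divide_right_mono) auto
    then have 1: "real (nat \<lfloor>x\<rfloor> div ell (Suc i * k)) / x \<le> 1 / real (ell (Suc i * k))"
      using that by simp
    have "ell (Suc i) > 0" by (intro ell_pos) simp
    moreover have "ell (Suc i) \<le> ell (Suc i * k)"
      using assms by (intro ell_mono dvd_triv_left) simp
    ultimately have "1 / real (ell (Suc i * k)) \<le> 1 / real (ell (Suc i))"
      by (intro divide_left_mono) auto
    with 1 have "real (nat \<lfloor>x\<rfloor> div ell (Suc i * k)) / x \<le> 1 / real (ell (Suc i))"
      by (rule order_trans)
    then have "\<bar>real_of_int (moebius_mu (Suc i))\<bar> * (real (nat \<lfloor>x\<rfloor> div ell (Suc i * k)) / x)
        \<le> \<bar>real_of_int (moebius_mu (Suc i))\<bar> * (1 / real (ell (Suc i)))"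
      by (rule mult_left_mono) simp
    then show ?thesis using that by (simp only: real_norm_def abs_mult abs_divide abs_of_nat abs_of_pos times_divide_eq_right mult_1_right)
  qed
  have "summable ?M" using summable_moebius_ell by (subst summable_Suc_iff)
  moreover have "eventually (\<lambda>(i, x). norm (?a i x) \<le> ?M i) (at_top \<times>\<^sub>F at_top)"
    using bound by (auto simp: case_prod_unfold intro!: eventually_mono[OF eventually_prodI[OF always_eventually eventually_gt_at_top[of "0::real"]]])
  \<comment> \<open>Tannery's theorem gives absolute convergence and the exchange of limit and sum
    together.\<close>
  ultimately have T: "summable (\<lambda>i. norm (?b i))" "((\<lambda>x. \<Sum>i. ?a i x) \<longlongrightarrow> suminf ?b) at_top"
    using tannerys_theorem[of ?a ?b at_top ?M, OF lim] by auto
  have count: "(\<Sum>i. ?a i x) = real (card {n \<in> gcd_fib_set k. 1 \<le> n \<and> real n \<le> x}) / x" if "x > 0" for x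
  proof -
    define N where "N = nat \<lfloor>x\<rfloor>"
    have "{n \<in> gcd_fib_set k. 1 \<le> n \<and> real n \<le> x} = {n \<in> gcd_fib_set k. n \<le> N}"
      using that by (auto simp: gcd_fib_set_def N_def le_nat_floor le_floor_iff) linarith
    then have "real (card {n \<in> gcd_fib_set k. 1 \<le> n \<and> real n \<le> x})
       = real_of_int (int (card {n \<in> gcd_fib_set k. n \<le> N}))" by simp
    also have "\<dots> = (\<Sum>d=1..N. real_of_int (moebius_mu d) * real (N div ell (d * k)))"
      using assms by (subst card_gcd_fib_set) auto
    also have "\<dots> = (\<Sum>i<N. real_of_int (moebius_mu (Suc i)) * real (N div ell (Suc i * k)))"
      by (simp add: sum.atLeast1_atMost_eq)
    finally have "real (card {n \<in> gcd_fib_set k. 1 \<le> n \<and> real n \<le> x}) / x = (\<Sum>i<N. ?a i x)"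
      by (simp add: sum_divide_distrib N_def)
    \<comment> \<open>The finite sum is a full series, since \<open>ell (d * k) \<ge> d > N\<close>
      makes every later quotient 0.\<close>
    also have "\<dots> = (\<Sum>i. ?a i x)"
    proof (rule suminf_finite[symmetric])
      fix i assume "i \<notin> {..<N}"
      then have "N < Suc i * 1" by simp
      also have "\<dots> \<le> Suc i * k" using assms by (intro mult_le_mono2)
      also have "\<dots> \<le> ell (Suc i * k)" using assms by (intro ell_ge) simp
      finally have "N < ell (Suc i * k)" .
      then show "?a i x = 0" by (simp add: N_def)
    qed simp
    finally show ?thesis ..
  qed
  have "has_asymptotic_density (gcd_fib_set k) (suminf ?b)"
    unfolding has_asymptotic_density_def
    by (rule Lim_transform_eventually[OF T(2) eventually_mono[OF eventually_gt_at_top[of 0] count]])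
  moreover have "?b sums suminf ?b"
    by (rule summable_sums[OF summable_norm_cancel[OF T(1)]])
  ultimately show ?thesis by blast
qed

end
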